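(* Consider positive constants $\ell$ and $r$, a point $(\bar x,\bar y)\in\mathbb{R}^n\times\mathbb{R}^n$, and a set-valued mapping $F:\mathbb{R}^n\rightrightarrows\mathbb{R}^n$ with $(\bar x,\bar y)\in\mathrm{gph}\,F$. Assume that $F$ has a closed graph and convex values, the set $F(\mathbb{B}[\bar x,r])$ is bounded, and that one of the following conditions holds: (C1) for each $x\in\mathbb{B}[\bar x,r]$ there is $y\in F(x)$ such that $\langle y-\bar y,x-\bar x\rangle\ge\ell\|x-\bar x\|^2$; (C2) for each $x\in\mathbb{B}[\bar x,r]$ there is $y\in F(x)$ such that $\langle \bar y-y,x-\bar x\rangle\ge\ell\|x-\bar x\|^2$. Then $\mathrm{lopen}\,F(\bar x,\bar y)\ge\ell$; more precisely, $$\mathbb{B}[\bar y,\ell t]\subset F(\mathbb{B}[\bar x,t])\quad\text{for each } t\in(0,r].$$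
   Context: $\mathbb{R}^n$ carries the Euclidean inner product $\langle\cdot,\cdot\rangle$ and norm; $\mathbb{B}[u,r]$ is the closed ball. $F:\mathbb{R}^n\rightrightarrows\mathbb{R}^n$ is a set-valued mapping (values may be empty), $\mathrm{gph}\,F=\{(x,y):y\in F(x)\}$, $F(C)=\bigcup_{x\in C}F(x)$. $\mathrm{lopen}\,F(\bar x,\bar y)$ is the supremum of all $c>0$ for which there is $\varepsilon>0$ such that $\mathbb{B}[\bar y,ct]\subset F(\mathbb{B}[\bar x,t])$ for each $t\in(0,\varepsilon)$ ($\sup\emptyset=0$). *)

theory Defs
  imports "HOL-Analysis.Analysis"
begin

text \<open>A set-valued mapping from \<^typ>\<open>'a\<close> to \<^typ>\<open>'b\<close> is a function \<^typ>\<open>'a \<Rightarrow> 'b set\<close>;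
  its values may be empty.\<close>

definition gph :: "('a \<Rightarrow> 'b set) \<Rightarrow> ('a \<times> 'b) set"
  where "gph F = {(x, y). y \<in> F x}"

definition set_image :: "('a \<Rightarrow> 'b set) \<Rightarrow> 'a set \<Rightarrow> 'b set"
  where "set_image F C = (\<Union>x\<in>C. F x)"

text \<open>The supremum is taken in the extended nonnegative reals: it may be infinite (e.g. when \<open>F\<close> is
  constant with \<open>ybar\<close> in the interior of its value), and there the empty supremum is 0. Only
  positive \<open>c\<close> enter, so the coercion \<^const>\<open>ennreal\<close> does not truncate.\<close>

definition lopen ::
    "('a::metric_space \<Rightarrow> 'b::metric_space set) \<Rightarrow> 'a \<Rightarrow> 'b \<Rightarrow> ennreal"
  where "lopen F xbar ybar =
    (SUP c \<in> {c::real. c > 0 \<and>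
       (\<exists>\<epsilon>>0. \<forall>t\<in>{0<..<\<epsilon>}. cball ybar (c * t) \<subseteq> set_image F (cball xbar t))}.
     ennreal c)"

end

theory Submission
  imports Defs
begin

text \<open>
  Fix \<open>t \<le> r\<close> and a target \<open>z\<close> with \<open>norm (z - ybar) \<le> l * t\<close>. Under the first condition the
  shifted map \<open>H x = F x - z\<close> points weakly outwards on the sphere of radius \<open>t\<close>: the point
  \<open>y \<in> F x\<close> provided by the hypothesis satisfies
  \<open>(y - z) \<bullet> (x - xbar) \<ge> l * t\<^sup>2 - norm (z - ybar) * t \<ge> 0\<close> by Cauchy-Schwarz.
  Under the second condition the same is true of \<open>z - F x\<close>. So everything reduces to the fact
  that a set-valued map with compact graph and nonempty convex values on a ball, which points weakly
  outwards on the boundary, has a zero (\<open>outward_set_valued_map_has_zero\<close>).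

  That fact is deduced from Brouwer's theorem by separation. If \<open>0 \<notin> H x\<close> for every \<open>x\<close>,
  each \<open>H x\<close> lies in an open half-space \<open>{y. p \<bullet> y > 0}\<close>, and compactness of the graph allows one to
  choose \<open>p\<close> as a continuous function of \<open>x\<close> (\<open>continuous_strict_separation_from_zero\<close>); it
  does not vanish because \<open>H x\<close> is nonempty. The map \<open>x \<mapsto> a - t p(x) / norm (p x)\<close> then sends
  the ball with centre \<open>a\<close> into its boundary, and at its fixed point \<open>x - a\<close> is a negative multiple
  of \<open>p x\<close>, so every \<open>y \<in> H x\<close> points strictly inwards: a contradiction.
\<close>

text \<open>For a fixed direction \<open>p\<close>, the points whose value is not contained in the half-space
  \<open>p \<bullet> y > 0\<close> form the projection of a compact set, hence a closed set. A direction that is good at a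
  point is therefore good nearby; as good directions form a convex cone, finitely many local choices
  can be glued with nonnegative continuous weights.\<close>

lemma continuous_strict_separation_from_zero:
  fixes H :: "'a::metric_space \<Rightarrow> 'b::euclidean_space set"
  assumes "compact K"
    and graph: "compact {(x, y). x \<in> K \<and> y \<in> H x}"
    and conv: "\<And>x. x \<in> K \<Longrightarrow> convex (H x)"
    and zero: "\<And>x. x \<in> K \<Longrightarrow> 0 \<notin> H x"
  obtains p where "continuous_on K p" "\<And>x y. x \<in> K \<Longrightarrow> y \<in> H x \<Longrightarrow> p x \<bullet> y > 0"
proof -
  define C where "C q = {x \<in> K. \<exists>y\<in>H x. q \<bullet> y \<le> 0}" for q
  have "closed (C q)" for q
  proof -
    have C_eq: "C q = fst ` ({(x, y). x \<in> K \<and> y \<in> H x} \<inter> {v. q \<bullet> snd v \<le> 0})"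
      by (force simp: C_def image_iff)
    have "closed {v::'a \<times> 'b. q \<bullet> snd v \<le> 0}"
      by (intro closed_Collect_le continuous_intros)
    from compact_Int_closed[OF graph this] show ?thesis
      unfolding C_eq by (intro compact_imp_closed compact_continuous_image
          continuous_on_fst continuous_on_id)
  qed
  have "\<exists>q. x \<notin> C q" if "x \<in> K" for x
  proof -
    have H_eq: "H x = snd ` ({(x, y). x \<in> K \<and> y \<in> H x} \<inter> ({x} \<times> UNIV))"
      using that by force
    have "closed ({x} \<times> (UNIV :: 'b set))"
      by (intro closed_Times) auto
    from compact_Int_closed[OF graph this] have "closed (H x)"
      by (subst H_eq) (intro compact_imp_closed compact_continuous_image
          continuous_on_snd continuous_on_id)
    with conv zero that obtain q b where "0 < b" "\<forall>y\<in>H x. q \<bullet> y > b"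
      using separating_hyperplane_closed_0[of "H x"] by blast
    then have "x \<notin> C q" by (force simp: C_def)
    then show ?thesis ..
  qed
  then have "K \<subseteq> (\<Union>q\<in>UNIV. - C q)" by blast
  then obtain Q where "finite Q" and cover: "K \<subseteq> (\<Union>q\<in>Q. - C q)"
    using \<open>compact K\<close> \<open>\<And>q. closed (C q)\<close>
    by (elim compactE_image[of K UNIV "\<lambda>q. - C q"]) auto
  \<comment> \<open>The distance to \<open>C q\<close> is the weight of \<open>q\<close>; the distance to the empty set is \<open>0\<close> by convention,
    which would lose the directions that are good everywhere.\<close>
  define w where "w q x = (if C q = {} then 1 else infdist x (C q))" for q x
  have w_cont: "continuous_on K (w q)" for q
    by (cases "C q = {}") (simp_all add: w_def[abs_def] continuous_on_infdist continuous_on_id)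
  have w_nonneg: "w q x \<ge> 0" for q x
    by (simp add: w_def infdist_nonneg)
  have w_pos: "w q x > 0 \<longleftrightarrow> x \<notin> C q" for q x
    using \<open>closed (C q)\<close> infdist_pos_not_in_closed[of "C q" x]
    by (auto simp: w_def)
  show ?thesis
  proof
    show "continuous_on K (\<lambda>x. \<Sum>q\<in>Q. w q x *\<^sub>R q)"
      by (intro continuous_intros w_cont)
    fix x y assume "x \<in> K" "y \<in> H x"
    have pos: "q \<bullet> y > 0" if "x \<notin> C q" for q
      using that \<open>x \<in> K\<close> \<open>y \<in> H x\<close> by (force simp: C_def)
    obtain q where "q \<in> Q" "x \<notin> C q"
      using cover \<open>x \<in> K\<close> by blast
    have "(\<Sum>q\<in>Q. w q x * (q \<bullet> y)) > 0"
    proof (rule sum_pos2[OF \<open>finite Q\<close> \<open>q \<in> Q\<close>])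
      show "0 < w q x * (q \<bullet> y)"
        using \<open>x \<notin> C q\<close> w_pos pos by simp
      show "0 \<le> w i x * (i \<bullet> y)" for i
        using w_nonneg[of i x] w_pos[of i x] pos[of i] by (cases "x \<in> C i") auto
    qed
    then show "(\<Sum>q\<in>Q. w q x *\<^sub>R q) \<bullet> y > 0"
      by (simp add: inner_sum_left)
  qed
qed

text \<open>A set-valued form of the theorem that a continuous vector field on a ball pointing
  outwards on the boundary has a zero. On the boundary a single outward value suffices,
  because the separating direction \<open>p x\<close> makes all of \<open>H x\<close> point strictly inwards at the fixed point.\<close>

lemma outward_set_valued_map_has_zero:
  fixes H :: "'a::euclidean_space \<Rightarrow> 'a set"
  assumes "t > 0"
    and graph: "compact {(x, y). x \<in> cball a t \<and> y \<in> H x}"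
    and conv: "\<And>x. x \<in> cball a t \<Longrightarrow> convex (H x)"
    and nonempty: "\<And>x. x \<in> cball a t \<Longrightarrow> H x \<noteq> {}"
    and outward: "\<And>x. x \<in> sphere a t \<Longrightarrow> \<exists>y\<in>H x. y \<bullet> (x - a) \<ge> 0"
  shows "\<exists>x\<in>cball a t. 0 \<in> H x"
proof (rule ccontr)
  assume "\<not> ?thesis"
  then obtain p where cont: "continuous_on (cball a t) p"
    and pos: "\<And>x y. x \<in> cball a t \<Longrightarrow> y \<in> H x \<Longrightarrow> p x \<bullet> y > 0"
    using continuous_strict_separation_from_zero[OF compact_cball graph conv] by blast
  have nz: "p x \<noteq> 0" if "x \<in> cball a t" for x
    using pos[OF that] nonempty[OF that] by fastforce
  define f where "f x = a - (t / norm (p x)) *\<^sub>R p x" for x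
  have on_sphere: "f x \<in> sphere a t" if "x \<in> cball a t" for x
    using nz[OF that] \<open>t > 0\<close> by (simp add: f_def dist_norm)
  have "continuous_on (cball a t) f"
    unfolding f_def using nz by (intro continuous_intros cont) auto
  moreover have "f ` cball a t \<subseteq> cball a t"
    using on_sphere sphere_cball by blast
  ultimately obtain x where x: "x \<in> cball a t" "f x = x"
    using brouwer_ball[OF \<open>t > 0\<close>, of a f] by blast
  then obtain y where y: "y \<in> H x" "y \<bullet> (x - a) \<ge> 0"
    using on_sphere outward by metis
  have "x - a = - ((t / norm (p x)) *\<^sub>R p x)"
    using x(2) by (simp add: f_def algebra_simps)
  then have "y \<bullet> (x - a) = - (t / norm (p x)) * (p x \<bullet> y)"
    by (simp add: inner_commute)
  moreover have "(t / norm (p x)) * (p x \<bullet> y) > 0"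
    using pos[OF x(1) y(1)] nz[OF x(1)] \<open>t > 0\<close> by simp
  ultimately show False using y(2) by simp
qed

text \<open>The sign \<open>s\<close> covers outward (\<open>s = 1\<close>) and inward (\<open>s = -1\<close>) pointing maps at once: the zero
  is found for \<open>s *\<^sub>R (F x - z)\<close>.\<close>

lemma cball_subset_set_image:
  fixes F :: "'a::euclidean_space \<Rightarrow> 'a set"
  assumes "t > 0" and "s \<noteq> 0"
    and closed_graph: "closed (gph F)"
    and conv: "\<And>x. x \<in> cball a t \<Longrightarrow> convex (F x)"
    and bdd: "bounded (set_image F (cball a t))"
    and growth: "\<And>x. x \<in> cball a t \<Longrightarrow>
      \<exists>y\<in>F x. (s *\<^sub>R (y - b)) \<bullet> (x - a) \<ge> \<bar>s\<bar> * l * (norm (x - a))\<^sup>2"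
  shows "cball b (l * t) \<subseteq> set_image F (cball a t)"
proof
  fix z assume "z \<in> cball b (l * t)"
  then have z: "norm (z - b) \<le> l * t"
    by (simp add: dist_norm norm_minus_commute)
  define H where "H x = (\<lambda>y. s *\<^sub>R (y - z)) ` F x" for x
  have "\<exists>x\<in>cball a t. 0 \<in> H x"
  proof (rule outward_set_valued_map_has_zero[OF \<open>t > 0\<close>])
    obtain M where M: "set_image F (cball a t) \<subseteq> cball 0 M"
      using bdd by (auto simp: bounded_iff subset_iff)
    have "{(x, y). x \<in> cball a t \<and> y \<in> H x}
        = (\<lambda>v. (fst v, s *\<^sub>R (snd v - z))) ` (gph F \<inter> (cball a t \<times> cball 0 M))"
      using M unfolding H_def gph_def set_image_def by (force simp: image_iff)
    moreover have "compact (gph F \<inter> (cball a t \<times> cball 0 M))"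
      by (intro closed_Int_compact closed_graph compact_Times compact_cball)
    ultimately show "compact {(x, y). x \<in> cball a t \<and> y \<in> H x}"
      by (auto intro!: compact_continuous_image continuous_intros)
  next
    fix x assume x: "x \<in> cball a t"
    have "H x = (*\<^sub>R) s ` ((\<lambda>y. y - z) ` F x)"
      by (auto simp: H_def)
    then show "convex (H x)"
      using conv[OF x] by (simp only: convex_scaling convex_translation_subtract)
    show "H x \<noteq> {}"
      using growth[OF x] by (auto simp: H_def)
  next
    fix x assume "x \<in> sphere a t"
    then have x: "x \<in> cball a t" "norm (x - a) = t"
      by (auto simp: dist_norm norm_minus_commute)
    from growth[OF x(1)] obtain y
      where y: "y \<in> F x" "(s *\<^sub>R (y - b)) \<bullet> (x - a) \<ge> \<bar>s\<bar> * l * t\<^sup>2"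
      unfolding x(2) by blast
    have "(s *\<^sub>R (z - b)) \<bullet> (x - a) \<le> norm (s *\<^sub>R (z - b)) * norm (x - a)"
      by (rule norm_cauchy_schwarz)
    also have "\<dots> \<le> (\<bar>s\<bar> * (l * t)) * t"
      using z x(2) \<open>t > 0\<close> by (simp add: mult_left_mono mult_right_mono)
    also have "\<dots> = \<bar>s\<bar> * l * t\<^sup>2"
      by (simp add: power2_eq_square)
    finally have "(s *\<^sub>R (y - z)) \<bullet> (x - a) \<ge> 0"
      using y(2) by (simp add: inner_diff_left algebra_simps)
    then show "\<exists>y\<in>H x. y \<bullet> (x - a) \<ge> 0"
      using y(1) by (auto simp: H_def)
  qed
  then show "z \<in> set_image F (cball a t)"
    using \<open>s \<noteq> 0\<close> by (auto simp: H_def set_image_def)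
qed

theorem theorem3p7:
  fixes l r :: real
    and xbar ybar :: "real ^ 'n"
    and F :: "real ^ 'n \<Rightarrow> (real ^ 'n) set"
  assumes "l > 0" and "r > 0"
    and "(xbar, ybar) \<in> gph F"
    and "closed (gph F)"
    and "\<And>x. convex (F x)"
    and "bounded (set_image F (cball xbar r))"
    and "(\<forall>x\<in>cball xbar r. \<exists>y\<in>F x. (y - ybar) \<bullet> (x - xbar) \<ge> l * (norm (x - xbar))\<^sup>2)
       \<or> (\<forall>x\<in>cball xbar r. \<exists>y\<in>F x. (ybar - y) \<bullet> (x - xbar) \<ge> l * (norm (x - xbar))\<^sup>2)"
  shows "lopen F xbar ybar \<ge> ennreal l
    \<and> (\<forall>t\<in>{0<..r}. cball ybar (l * t) \<subseteq> set_image F (cball xbar t))"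
proof -
  have "\<exists>s\<in>{1, -1}. \<forall>x\<in>cball xbar r.
      \<exists>y\<in>F x. (s *\<^sub>R (y - ybar)) \<bullet> (x - xbar) \<ge> \<bar>s\<bar> * l * (norm (x - xbar))\<^sup>2"
    using assms(7) by (simp add: inner_diff_left)
  then obtain s :: real where "s \<in> {1, -1}" and growth: "\<forall>x\<in>cball xbar r.
      \<exists>y\<in>F x. (s *\<^sub>R (y - ybar)) \<bullet> (x - xbar) \<ge> \<bar>s\<bar> * l * (norm (x - xbar))\<^sup>2" ..
  then have "s \<noteq> 0" by auto
  have covers: "cball ybar (l * t) \<subseteq> set_image F (cball xbar t)" if "t \<in> {0<..r}" for t
  proof (rule cball_subset_set_image[OF _ \<open>s \<noteq> 0\<close> assms(4)])
    have sub: "cball xbar t \<subseteq> cball xbar r"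
      using that by (simp add: subset_cball)
    then show "bounded (set_image F (cball xbar t))"
      by (intro bounded_subset[OF assms(6)]) (auto simp: set_image_def)
    show "\<exists>y\<in>F x. (s *\<^sub>R (y - ybar)) \<bullet> (x - xbar) \<ge> \<bar>s\<bar> * l * (norm (x - xbar))\<^sup>2"
      if "x \<in> cball xbar t" for x
      using growth sub that by blast
  qed (use that assms(5) in auto)
  have "\<forall>t\<in>{0<..<r}. cball ybar (l * t) \<subseteq> set_image F (cball xbar t)"
    by (intro ballI covers) simp
  with \<open>r > 0\<close> have "\<exists>\<epsilon>>0. \<forall>t\<in>{0<..<\<epsilon>}. cball ybar (l * t) \<subseteq> set_image F (cball xbar t)"
    by blast
  with \<open>l > 0\<close> have "lopen F xbar ybar \<ge> ennreal l"
    unfolding lopen_def by (intro SUP_upper) blast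
  with covers show ?thesis by blast
qed

end
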